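(* For $a>0$ and real $x$ with $|x|<a$, $$\sum_{n=2}^{\infty} H_n\left[\zeta(n,a) - x\,\zeta(n+1,a)\right]x^n = \zeta(2,a)x^2 + \psi(a)x + \log\Gamma(a-x) - \log\Gamma(a).$$
   Context: $\zeta(s,a)=\sum_{k=0}^\infty (k+a)^{-s}$ ($\mathrm{Re}\, s>1$, $a>0$) is the Hurwitz zeta function. $\psi=\Gamma'/\Gamma$ is the digamma function. $H_n=1+\frac12+\dots+\frac1n$ are the harmonic numbers. $\log$ is the natural logarithm. *)

theory Defs
  imports "HOL-Analysis.Analysis"
begin

text \<open>
  The series only converges for \<open>Re s > 1\<close>. The type of \<open>s\<close> is either \<^typ>\<open>real\<close> or
  \<^typ>\<open>complex\<close>, with the value in the same type.
\<close>

definition hurwitz_zeta :: "'a :: {real_normed_field, ln} \<Rightarrow> real \<Rightarrow> 'a" where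
  "hurwitz_zeta s a = (\<Sum>k. of_real (real k + a) powr (- s))"

end

theory Submission
  imports Defs
begin

text \<open>
  Expanding \<open>\<zeta>(n,a)\<close> and exchanging the order of summation turns
  \<open>\<Sum>n\<ge>2. \<zeta>(n,a) x\<^sup>n / n\<close> into \<open>\<Sum>k. - ln (1 - x/(a+k)) - x/(a+k)\<close>, which the product
  formulas for \<open>\<Gamma>(a-x)\<close> and \<open>\<Gamma>(a)\<close> and the limit formula for \<open>\<psi>(a)\<close> evaluate as
  \<open>ln \<Gamma>(a-x) - ln \<Gamma>(a) + \<psi>(a) x\<close>. Since \<open>H\<^sub>n - H\<^sub>n\<^sub>-\<^sub>1 = 1/n\<close>, summation by parts
  relates the series with harmonic numbers to this one, with boundary term
  \<open>H\<^sub>n \<zeta>(n+1,a) x\<^sup>n\<^sup>+\<^sup>1 \<longrightarrow> 0\<close>.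
\<close>

lemma hurwitz_zeta_of_nat_sums:
  fixes a :: real
  assumes "a > 0" and "n \<ge> 2"
  shows "(\<lambda>k. inverse ((a + real k) ^ n)) sums hurwitz_zeta (real n) a"
proof -
  have "(real k + a) powr (- real n) = inverse ((a + real k) ^ n)" for k
    using assms by (simp add: powr_minus powr_realpow add.commute)
  moreover have "summable (\<lambda>k. inverse ((a + real k) ^ n))"
    using assms Polygamma_converges'[of a n] by simp
  ultimately show ?thesis
    by (simp add: hurwitz_zeta_def summable_sums)
qed

text \<open>Every base \<open>a + real k\<close> is at least \<open>a\<close>, so \<open>n\<close>
  of the \<open>n + 2\<close> factors can be bounded by \<open>a ^ n\<close>; the remaining two keep
  the sum over \<open>k\<close> convergent. The resulting geometric decay is what lets |x| < a
  outweigh the harmonic numbers.\<close>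

lemma hurwitz_zeta_le:
  fixes a :: real
  assumes "a > 0"
  shows "\<bar>hurwitz_zeta (real (n + 2)) a\<bar> \<le> hurwitz_zeta 2 a / a ^ n"
proof -
  have sums: "(\<lambda>k. inverse ((a + real k) ^ (n + 2))) sums hurwitz_zeta (real (n + 2)) a"
    using assms by (intro hurwitz_zeta_of_nat_sums) auto
  have sums2: "(\<lambda>k. inverse ((a + real k) ^ 2) / a ^ n) sums (hurwitz_zeta 2 a / a ^ n)"
    using hurwitz_zeta_of_nat_sums[of a 2] assms by (intro sums_divide) auto
  have le: "inverse ((a + real k) ^ (n + 2)) \<le> inverse ((a + real k) ^ 2) / a ^ n" for k
  proof -
    have "a ^ n \<le> (a + real k) ^ n"
      using assms by (intro power_mono) auto
    hence "inverse ((a + real k) ^ n) \<le> inverse (a ^ n)"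
      using assms by (intro le_imp_inverse_le) auto
    hence "inverse ((a + real k) ^ 2) * inverse ((a + real k) ^ n)
             \<le> inverse ((a + real k) ^ 2) * inverse (a ^ n)"
      by (intro mult_left_mono) auto
    thus ?thesis
      by (simp add: power_add power2_eq_square divide_inverse mult_ac)
  qed
  have "0 \<le> hurwitz_zeta (real (n + 2)) a"
    using assms by (intro sums_le[OF _ sums_zero sums]) auto
  moreover have "hurwitz_zeta (real (n + 2)) a \<le> hurwitz_zeta 2 a / a ^ n"
    by (rule sums_le[OF le sums sums2])
  ultimately show ?thesis
    by simp
qed

text \<open>Mercator's series without its linear term, as an unconditional sum, because it becomes a
  row of a double family that is later summed in the other order.\<close>

lemma has_sum_ln_one_minus_tail:
  fixes y :: real
  assumes "\<bar>y\<bar> < 1"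
  shows "((\<lambda>m. y ^ (m + 2) / real (m + 2)) has_sum (- ln (1 - y) - y)) UNIV"
proof (rule norm_summable_imp_has_sum)
  show "summable (\<lambda>m. norm (y ^ (m + 2) / real (m + 2)))"
    using summable_ignore_initial_segment[OF norm_summable_ln_series[of y], of 2] assms by simp
  \<comment> \<open>The term at \<open>n = 0\<close> is a division by zero and hence 0, so dropping
    two terms removes just \<open>y\<close>.\<close>
  have "(\<lambda>n. y ^ n / real n) sums (- ln (1 - y))"
    using sums_minus[OF ln_series'[of "- y"]] assms by simp
  from sums_split_initial_segment[OF this, of 2]
  show "(\<lambda>m. y ^ (m + 2) / real (m + 2)) sums (- ln (1 - y) - y)"
    by (simp add: numeral_2_eq_2)
qed

lemma ln_Gamma_diff_sums:
  fixes a x :: real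
  assumes "a > 0" and "x < a"
  shows "(\<lambda>k. - ln (1 - x / (a + real k)) - x / (a + real k))
           sums (ln (Gamma (a - x)) - ln (Gamma a) + Digamma a * x)"
proof -
  \<comment> \<open>These are the logarithms in \<open>ln_Gamma_series\<close>, which divide by
    \<open>k\<close>. The case \<open>k = 0\<close> is \<open>ln_diff0\<close>, matching the
    separate term \<open>- ln z\<close> of that series.\<close>
  have ln_diff: "ln (1 - x / (a + real k)) = ln ((a - x) / real k + 1) - ln (a / real k + 1)"
    if "k > 0" for k
  proof -
    have "1 - x / (a + real k) = ((a - x) / real k + 1) / (a / real k + 1)"
    proof -
      have "(a - x) / real k + 1 = (a - x + real k) / real k"
        and "a / real k + 1 = (a + real k) / real k"
        using that by (simp_all add: field_simps)
      moreover have "1 - x / (a + real k) = (a - x + real k) / (a + real k)"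
        using assms by (subst eq_divide_eq) (auto simp: left_diff_distrib)
      ultimately show ?thesis
        using that by simp
    qed
    moreover have "(a - x) / real k + 1 > 0" "a / real k + 1 > 0"
      using assms that by (auto intro!: add_pos_pos)
    ultimately show ?thesis
      by (simp add: ln_div)
  qed
  have ln_diff0: "ln (1 - x / a) = ln (a - x) - ln a"
    using ln_div[of "a - x" a] assms by (simp add: diff_divide_distrib)
  \<comment> \<open>\<open>ln_Gamma_series\<close> at \<open>n\<close> involves the indices 0 to
    \<open>n\<close>, whereas the limit formula for \<open>Digamma\<close> sums only over
    \<open>k < n\<close>. The last summand makes up for this and tends to 0. The term
    \<open>ln (real n) * x\<close> cancels the difference of the terms \<open>z * ln n\<close> in
    the two series.\<close>
  have partial: "(\<Sum>k<Suc n. - ln (1 - x / (a + real k)) - x / (a + real k)) =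
      ln_Gamma_series (a - x) n - ln_Gamma_series a n
        + (ln (real n) - (\<Sum>k<n. inverse (a + real k))) * x - inverse (a + real n) * x" for n
  proof -
    have "(\<Sum>k<Suc n. ln (1 - x / (a + real k))) =
            ln (1 - x / a) + (\<Sum>k=1..n. ln (1 - x / (a + real k)))"
      by (subst sum.lessThan_Suc_shift) (simp add: sum.atLeast1_atMost_eq)
    also have "(\<Sum>k=1..n. ln (1 - x / (a + real k))) =
                 (\<Sum>k=1..n. ln ((a - x) / real k + 1) - ln (a / real k + 1))"
      by (intro sum.cong refl ln_diff) auto
    finally have "(\<Sum>k<Suc n. ln (1 - x / (a + real k))) =
        ln_Gamma_series a n - ln_Gamma_series (a - x) n - ln (real n) * x"
      by (simp add: ln_diff0 ln_Gamma_series_def sum_subtractf algebra_simps del: sum.lessThan_Suc)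
    moreover have "(\<Sum>k<Suc n. x / (a + real k)) =
        (\<Sum>k<n. inverse (a + real k)) * x + inverse (a + real n) * x"
      by (simp add: sum_distrib_left divide_inverse mult.commute)
    ultimately show ?thesis
      by (simp add: sum_subtractf sum_negf algebra_simps del: sum.lessThan_Suc)
  qed
  have "(\<lambda>n. inverse (a + real n)) \<longlonglongrightarrow> 0"
    by (intro tendsto_inverse_0_at_top filterlim_tendsto_add_at_top[OF tendsto_const]
          filterlim_real_sequentially)
  hence "(\<lambda>n. ln_Gamma_series (a - x) n - ln_Gamma_series a n
        + (ln (real n) - (\<Sum>k<n. inverse (a + real k))) * x - inverse (a + real n) * x)
      \<longlonglongrightarrow> ln_Gamma (a - x) - ln_Gamma a + Digamma a * x - 0 * x"
    using Digamma_LIMSEQ[of a] assms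
    by (intro tendsto_intros ln_Gamma_real_LIMSEQ) auto
  hence "(\<lambda>n. \<Sum>k<Suc n. - ln (1 - x / (a + real k)) - x / (a + real k))
           \<longlonglongrightarrow> ln (Gamma (a - x)) - ln (Gamma a) + Digamma a * x"
    unfolding partial using assms by (simp add: ln_Gamma_real_pos)
  thus ?thesis
    unfolding sums_def by (rule LIMSEQ_imp_Suc)
qed

lemma hurwitz_zeta_power_series_sums:
  fixes a x :: real
  assumes "a > 0" and "\<bar>x\<bar> < a"
  shows "(\<lambda>m. hurwitz_zeta (real (m + 2)) a * x ^ (m + 2) / real (m + 2))
           sums (ln (Gamma (a - x)) - ln (Gamma a) + Digamma a * x)"
proof -
  define f where "f y = (\<lambda>(k, m). (y / (a + real k)) ^ (m + 2) / real (m + 2))" for y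
  define g where "g y k = - ln (1 - y / (a + real k)) - y / (a + real k)" for y k
  have row: "((\<lambda>m. f y (k, m)) has_sum g y k) UNIV" if "\<bar>y\<bar> < a" for y k
    using has_sum_ln_one_minus_tail[of "y / (a + real k)"] assms that
    by (simp add: f_def g_def)
  \<comment> \<open>Passing to norms only replaces x by |x|, which satisfies the same bound.
    Absolute summability of the double family thus follows from the nonnegative row sums at
    |x|.\<close>
  have norm_f: "norm (f x p) = f \<bar>x\<bar> p" for p
    using assms by (simp add: f_def case_prod_unfold abs_mult power_abs)
  have "(\<lambda>k. g \<bar>x\<bar> k) sums (ln (Gamma (a - \<bar>x\<bar>)) - ln (Gamma a) + Digamma a * \<bar>x\<bar>)"
    unfolding g_def using assms by (intro ln_Gamma_diff_sums) auto
  moreover have "g \<bar>x\<bar> k \<ge> 0" for k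
    by (rule has_sum_nonneg[OF row]) (use assms in \<open>auto simp: f_def\<close>)
  ultimately have g_abs: "g \<bar>x\<bar> summable_on UNIV"
    by (intro summable_nonneg_imp_summable_on) (auto simp: sums_iff)
  have "f \<bar>x\<bar> summable_on (UNIV \<times> UNIV)"
    by (rule summable_on_SigmaI[OF row g_abs]) (use assms in \<open>auto simp: f_def\<close>)
  hence "(\<lambda>p. norm (f x p)) summable_on (UNIV \<times> UNIV)"
    by (simp only: norm_f)
  hence summable: "f x summable_on (UNIV \<times> UNIV)"
    by (rule abs_summable_summable)
  then obtain S where S: "(f x has_sum S) (UNIV \<times> UNIV)"
    by (auto simp: summable_on_def)
  \<comment> \<open>Summing over \<open>m\<close> first gives the value of \<open>S\<close>; summing
    over \<open>k\<close> first, below, gives the zeta series.\<close>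
  have "(g x has_sum S) UNIV"
    by (rule has_sum_SigmaD[OF S]) (use assms in \<open>auto intro: row\<close>)
  hence S_eq: "S = ln (Gamma (a - x)) - ln (Gamma a) + Digamma a * x"
    using ln_Gamma_diff_sums[of a x] assms
    by (auto dest!: has_sum_imp_sums simp: g_def[abs_def] intro: sums_unique2)
  have S': "((\<lambda>(m, k). f x (k, m)) has_sum S) (UNIV \<times> UNIV)"
    using S by (subst (asm) has_sum_swap)
  have "((\<lambda>m. hurwitz_zeta (real (m + 2)) a * x ^ (m + 2) / real (m + 2)) has_sum S) UNIV"
  proof (rule has_sum_SigmaD[OF S'])
    fix m
    have "((\<lambda>k. inverse ((a + real k) ^ (m + 2))) has_sum hurwitz_zeta (real (m + 2)) a) UNIV"
      using hurwitz_zeta_of_nat_sums[of a "m + 2"] assms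
      by (intro sums_nonneg_imp_has_sum) auto
    from has_sum_cmult_left[OF this, of "x ^ (m + 2) / real (m + 2)"]
    show "((\<lambda>k. case (m, k) of (m, k) \<Rightarrow> f x (k, m)) has_sum
            hurwitz_zeta (real (m + 2)) a * x ^ (m + 2) / real (m + 2)) UNIV"
      by (simp add: f_def power_mult_distrib power_inverse divide_inverse mult_ac)
  qed
  thus ?thesis
    unfolding S_eq by (rule has_sum_imp_sums)
qed

lemma harm_le_of_nat: "harm n \<le> (of_nat n :: real)"
proof (induction n)
  case (Suc n)
  have "inverse (real (Suc n)) \<le> 1"
    by (simp add: inverse_eq_divide)
  with Suc show ?case
    by (simp add: harm_Suc)
qed (simp add: harm_def)

lemma harm_hurwitz_zeta_tendsto_0:
  fixes a x :: real
  assumes "a > 0" and "\<bar>x\<bar> < a"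
  shows "(\<lambda>n. harm (n + 1) * hurwitz_zeta (real (n + 2)) a * x ^ n) \<longlonglongrightarrow> 0"
proof (rule Lim_null_comparison)
  let ?q = "\<bar>x\<bar> / a"
  have nonneg: "0 \<le> (hurwitz_zeta 2 a :: real)"
    using hurwitz_zeta_le[OF assms(1), of 0] by simp
  \<comment> \<open>The crude bound \<open>harm (n + 1)\<close> \<le> \<open>n + 1\<close> suffices
    against the geometric factor \<open>?q ^ n\<close>.\<close>
  have "norm (harm (n + 1) * hurwitz_zeta (real (n + 2)) a * x ^ n)
          \<le> hurwitz_zeta 2 a * (real n * ?q ^ n + ?q ^ n)" for n
  proof -
    have "\<bar>harm (n + 1) * hurwitz_zeta (real (n + 2)) a * x ^ n\<bar>
            \<le> real (n + 1) * (hurwitz_zeta 2 a / a ^ n) * \<bar>x\<bar> ^ n"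
      unfolding abs_mult abs_harm power_abs
      using hurwitz_zeta_le[OF assms(1), of n] harm_le_of_nat[of "n + 1"]
      by (intro mult_mono) (auto simp: harm_nonneg nonneg assms less_imp_le)
    thus ?thesis
      by (simp add: power_divide algebra_simps add_divide_distrib)
  qed
  thus "\<forall>\<^sub>F n in sequentially. norm (harm (n + 1) * hurwitz_zeta (real (n + 2)) a * x ^ n)
          \<le> hurwitz_zeta 2 a * (real n * ?q ^ n + ?q ^ n)"
    by simp
  have "(\<lambda>n. real n * ?q ^ n + ?q ^ n) \<longlonglongrightarrow> 0 + 0"
    using powser_times_n_limit_0[of ?q] assms
    by (intro tendsto_add LIMSEQ_power_zero) auto
  thus "(\<lambda>n. hurwitz_zeta 2 a * (real n * ?q ^ n + ?q ^ n)) \<longlonglongrightarrow> 0"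
    by (intro tendsto_mult_right_zero) simp
qed

theorem theorem2:
  fixes a x :: real
  assumes "a > 0" and "\<bar>x\<bar> < a"
  shows "(\<lambda>m. let n = m + 2 in
            harm n * (hurwitz_zeta (real n) a - x * hurwitz_zeta (real (n + 1)) a) * x ^ n)
         sums (hurwitz_zeta 2 a * x\<^sup>2 + Digamma a * x + ln (Gamma (a - x)) - ln (Gamma a))"
proof -
  define z where "z n = hurwitz_zeta (real n) a" for n
  \<comment> \<open>With n = m + 2 this is H_(n-1) zeta(n,a) x^n, and \<open>B (Suc m)\<close> is
    H_n zeta(n+1,a) x^(n+1), the subtracted part of the n-th term. The remaining part exceeds
    \<open>B m\<close> by zeta(n,a) x^n / n.\<close>
  define B where "B m = harm (m + 1) * z (m + 2) * x ^ (m + 2)" for m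
  have term_eq: "harm (m + 2) * (z (m + 2) - x * z (m + 3)) * x ^ (m + 2) =
      z (m + 2) * x ^ (m + 2) / real (m + 2) + (B m - B (Suc m))" for m
  proof -
    have "harm (m + 2) = harm (m + 1) + inverse (real (m + 2))"
      using harm_Suc[of "m + 1", where ?'a = real] by simp
    moreover have "B (Suc m) = harm (m + 2) * z (m + 3) * x ^ (m + 3)"
      by (simp add: B_def numeral_2_eq_2 numeral_3_eq_3)
    ultimately show ?thesis
      by (simp add: B_def power_add power2_eq_square power3_eq_cube divide_inverse algebra_simps)
  qed
  have "B \<longlonglongrightarrow> 0"
    using tendsto_mult_left_zero[OF harm_hurwitz_zeta_tendsto_0[OF assms], of "x\<^sup>2"]
    by (simp add: B_def[abs_def] z_def power_add power2_eq_square mult_ac)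
  hence "(\<lambda>m. B m - B (Suc m)) sums (B 0 - 0)"
    by (rule telescope_sums')
  \<comment> \<open>Since H_1 = 1, the telescoping sum leaves exactly the zeta(2,a) term of the
    result.\<close>
  moreover have "B 0 = hurwitz_zeta 2 a * x\<^sup>2"
    by (simp add: B_def z_def harm_expand power2_eq_square)
  ultimately have "(\<lambda>m. harm (m + 2) * (z (m + 2) - x * z (m + 3)) * x ^ (m + 2)) sums
      (ln (Gamma (a - x)) - ln (Gamma a) + Digamma a * x + hurwitz_zeta 2 a * x\<^sup>2)"
    unfolding term_eq using hurwitz_zeta_power_series_sums[OF assms]
    by (auto simp: z_def intro!: sums_add)
  thus ?thesis
    by (simp add: z_def Let_def algebra_simps)
qed

end
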